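(* Let $\alpha$ and $\beta$ be finite (possibly empty) sequences of positive integers and let $G=\alpha\circledcirc\beta$ be the single-pitch mis\`ere \textsc{cricket pitch} position with the bumps of $\alpha$ to the left of the roller and the bumps of $\beta$ to its right. Write $o(\cdot)$ for the mis\`ere outcome class. \begin{enumerate} \item If $o(\alpha\circledcirc)=\mathcal{R}$ and $o(\circledcirc\beta)=\mathcal{L}$, then $o(G)=\mathcal{P}$. \item If $o(\alpha\circledcirc)=\mathcal{R}$ and $o(\circledcirc\beta)=\mathcal{N}$, then $o(G)=\mathcal{R}$. \item If $o(\alpha\circledcirc)=\mathcal{N}$ and $o(\circledcirc\beta)=\mathcal{L}$, then $o(G)=\mathcal{L}$. \end{enumerate}
   Context: \textsc{cricket pitch}: a position is a finite row of bumps (non-negative integers) with one roller placed between two bumps or at one end; it is written $a_m\,a_{m-1}\ldots a_1\circledcirc b_1\,b_2\ldots b_n$, where $\circledcirc$ is the roller, so $a_1$ and $b_1$ are the bumps adjacent to the roller. Left moves the roller to the left over any positive number of consecutive bumps; Right moves it to the right over any positive number of consecutive bumps. Each bump rolled over is reduced by $1$. A bump of value $0$ is no longer a bump and can no longer be rolled over (the roller cannot pass it). $\alpha\circledcirc$ denotes the position with the bumps of $\alpha$ to the left of the roller and nothing to its right, and $\circledcirc\beta$ the analogous position. Mis\`ere play: the player who cannot move on their turn wins. Outcome classes: $\mathcal{L}$ (Left wins whoever moves first), $\mathcal{R}$ (Right wins whoever moves first), $\mathcal{N}$ (the player moving first wins), $\mathcal{P}$ (the player moving second wins). *)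

theory Defs
  imports Main
begin

datatype player = Left | Right

fun opponent :: "player \<Rightarrow> player" where
  "opponent Left = Right"
| "opponent Right = Left"

text \<open>
  Both lists are read from left to right as displayed on the pitch, so the bumps adjacent to
  the roller in \<open>\<alpha> \<circledcirc> \<beta>\<close> are \<open>last \<alpha>\<close> and \<open>hd \<beta>\<close>.
  Bumps that have been flattened to \<open>0\<close> stay in the row, as obstacles.
\<close>

datatype position = Pitch "nat list" "nat list"  (infix "\<circledcirc>" 60)

text \<open>The list \<open>\<delta>\<close> consists of the bumps being rolled over.\<close>

inductive move :: "player \<Rightarrow> position \<Rightarrow> position \<Rightarrow> bool" where
  move_Left: "\<delta> \<noteq> [] \<Longrightarrow> (\<forall>d\<in>set \<delta>. 0 < d) \<Longrightarrow>
    move Left ((\<alpha> @ \<delta>) \<circledcirc> \<beta>) (\<alpha> \<circledcirc> (map (\<lambda>d. d - 1) \<delta> @ \<beta>))"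
| move_Right: "\<delta> \<noteq> [] \<Longrightarrow> (\<forall>d\<in>set \<delta>. 0 < d) \<Longrightarrow>
    move Right (\<alpha> \<circledcirc> (\<delta> @ \<beta>)) ((\<alpha> @ map (\<lambda>d. d - 1) \<delta>) \<circledcirc> \<beta>)"

fun total_height :: "position \<Rightarrow> nat" where
  "total_height (\<alpha> \<circledcirc> \<beta>) = sum_list \<alpha> + sum_list \<beta>"

lemma sum_list_roll_less:
  assumes "\<delta> \<noteq> []" "\<forall>d\<in>set \<delta>. 0 < d"
  shows "sum_list (map (\<lambda>d. d - 1) \<delta>) < sum_list (\<delta> :: nat list)"
  using assms
proof (induction \<delta>)
  case (Cons d \<delta>)
  then show ?case by (cases "\<delta> = []") auto
qed simp

lemma move_total_height_less: "move p G H \<Longrightarrow> total_height H < total_height G"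
  by (induction rule: move.induct) (auto dest: sum_list_roll_less)

text \<open>Makes the hypothesis \<open>move p G H\<close> available in the termination proof below.\<close>

declare conj_cong [fundef_cong]

text \<open>
  \<open>wins_first p G\<close>: under misere play, player \<open>p\<close> wins \<open>G\<close> when \<open>p\<close> is the one to move.
\<close>

function wins_first :: "player \<Rightarrow> position \<Rightarrow> bool" where
  "wins_first p G \<longleftrightarrow>
     (\<nexists>H. move p G H) \<or> (\<exists>H. move p G H \<and> \<not> wins_first (opponent p) H)"
  by pat_completeness auto
termination
  by (relation "measure (\<lambda>(p, G). total_height G)") (auto dest: move_total_height_less)

text \<open>The defining equation is not a terminating rewrite rule.\<close>

declare wins_first.simps [simp del]

datatype outcome = \<L> | \<R> | \<N> | \<P>

definition misere_outcome :: "position \<Rightarrow> outcome" where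
  "misere_outcome G =
     (if wins_first Left G
      then (if wins_first Right G then \<N> else \<L>)
      else (if wins_first Right G then \<R> else \<P>))"

end

(* Only Left can move in \<alpha> \<circledcirc>, so its outcome says whether Left loses it when moving first, and
   likewise for \<circledcirc> \<beta> and Right. A position that Left loses moving first stays lost when bumps are
   added at the far right: Right answers as before, since the bumps just rolled over by Left
   separate the roller from the new ones. It also stays lost when a row \<alpha> with \<alpha> \<circledcirc> lost for Left is
   added at the far left: if Left rolls into \<alpha>, Right answers as in \<alpha> \<circledcirc>, and the other bumps are
   then far right additions. Mirror images give the statements for Right. *)

theory Submission
  imports Defs
begin

fun mirror :: "position \<Rightarrow> position" where
  "mirror (\<alpha> \<circledcirc> \<beta>) = rev \<beta> \<circledcirc> rev \<alpha>"

lemma mirror_mirror [simp]: "mirror (mirror G) = G"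
  by (cases G) simp

lemma opponent_opponent [simp]: "opponent (opponent p) = p"
  by (cases p) simp_all

lemma move_mirror: "move p G H \<Longrightarrow> move (opponent p) (mirror G) (mirror H)"
proof (induction rule: move.induct)
  case (move_Left \<delta> \<alpha> \<beta>)
  then show ?case
    using move_Right[of "rev \<delta>" "rev \<beta>" "rev \<alpha>"] by (simp add: rev_map)
next
  case (move_Right \<delta> \<alpha> \<beta>)
  then show ?case
    using move_Left[of "rev \<delta>" "rev \<beta>" "rev \<alpha>"] by (simp add: rev_map)
qed

lemma move_mirror_iff: "move (opponent p) (mirror G) H \<longleftrightarrow> move p G (mirror H)"
  by (metis move_mirror mirror_mirror opponent_opponent)

lemma wins_first_mirror: "wins_first (opponent p) (mirror G) \<longleftrightarrow> wins_first p G"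
proof (induction p G rule: wins_first.induct)
  case (1 p G)
  \<comment> \<open>\<open>mirror\<close> is an involution, so a quantifier over all positions may
    be reindexed along it.\<close>
  have ex_mirror: "(\<exists>H. Q (mirror H)) \<longleftrightarrow> (\<exists>H. Q H)" for Q
    by (metis mirror_mirror)
  have "wins_first (opponent p) (mirror G) \<longleftrightarrow>
      (\<nexists>H. move (opponent p) (mirror G) H) \<or>
      (\<exists>H. move (opponent p) (mirror G) H \<and> \<not> wins_first p H)"
    using wins_first.simps[of "opponent p" "mirror G"] by simp
  also have "\<dots> \<longleftrightarrow> (\<nexists>H. move p G H) \<or> (\<exists>H. move p G H \<and> \<not> wins_first p (mirror H))"
    unfolding move_mirror_iff using ex_mirror[of "move p G"]
      ex_mirror[of "\<lambda>H. move p G H \<and> \<not> wins_first p (mirror H)"] by simp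
  \<comment> \<open>The conjunct \<open>move p G H\<close> supplies the guard of the induction
    hypothesis.\<close>
  also have "\<dots> \<longleftrightarrow> (\<nexists>H. move p G H) \<or> (\<exists>H. move p G H \<and> \<not> wins_first (opponent p) H)"
    using "1.IH" by auto
  also have "\<dots> \<longleftrightarrow> wins_first p G"
    by (rule wins_first.simps[symmetric])
  finally show ?case .
qed

lemma move_Left_iff:
  "move Left (\<alpha> \<circledcirc> \<beta>) H \<longleftrightarrow>
     (\<exists>\<alpha>' \<delta>. \<alpha> = \<alpha>' @ \<delta> \<and> \<delta> \<noteq> [] \<and> (\<forall>d\<in>set \<delta>. 0 < d) \<and> H = \<alpha>' \<circledcirc> (map (\<lambda>d. d - 1) \<delta> @ \<beta>))"
  by (auto simp: move.simps)

lemma move_Right_iff: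
  "move Right (\<alpha> \<circledcirc> \<beta>) H \<longleftrightarrow>
     (\<exists>\<delta> \<beta>'. \<beta> = \<delta> @ \<beta>' \<and> \<delta> \<noteq> [] \<and> (\<forall>d\<in>set \<delta>. 0 < d) \<and> H = (\<alpha> @ map (\<lambda>d. d - 1) \<delta>) \<circledcirc> \<beta>')"
  by (auto simp: move.simps)

text \<open>If any roll is legal, so is the one over the nearest bump alone.\<close>

lemma Right_can_move_iff: "(\<exists>H. move Right (\<alpha> \<circledcirc> \<beta>) H) \<longleftrightarrow> \<beta> \<noteq> [] \<and> 0 < hd \<beta>"
proof
  assume "\<beta> \<noteq> [] \<and> 0 < hd \<beta>"
  then have "move Right (\<alpha> \<circledcirc> ([hd \<beta>] @ tl \<beta>)) ((\<alpha> @ map (\<lambda>d. d - 1) [hd \<beta>]) \<circledcirc> tl \<beta>)"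
    by (intro move_Right) simp_all
  then show "\<exists>H. move Right (\<alpha> \<circledcirc> \<beta>) H"
    using \<open>\<beta> \<noteq> [] \<and> 0 < hd \<beta>\<close> by auto
qed (auto simp: move_Right_iff)

lemma Right_wins_first_iff:
  "wins_first Right (\<alpha> \<circledcirc> \<beta>) \<longleftrightarrow> \<beta> = [] \<or> hd \<beta> = 0 \<or>
     (\<exists>\<delta> \<beta>'. \<beta> = \<delta> @ \<beta>' \<and> \<delta> \<noteq> [] \<and> (\<forall>d\<in>set \<delta>. 0 < d) \<and>
       \<not> wins_first Left ((\<alpha> @ map (\<lambda>d. d - 1) \<delta>) \<circledcirc> \<beta>'))"
  by (subst wins_first.simps) (auto simp: Right_can_move_iff move_Right_iff)

lemma Left_loses_first_iff:
  "\<not> wins_first Left G \<longleftrightarrow> (\<exists>H. move Left G H) \<and> (\<forall>H. move Left G H \<longrightarrow> wins_first Right H)"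
  by (subst wins_first.simps) auto

text \<open>Common step of both extension results. If \<open>hd \<gamma>\<close> is flat, Right is
  still blocked and wins at once; otherwise the old winning roll is still legal, and the last
  hypothesis keeps its result lost for Left. An empty \<open>\<gamma>\<close> must be excluded:
  there Right wins by being stuck, and the new bumps \<open>\<beta>\<close> could free a
  move.\<close>

lemma Right_wins_first_append:
  assumes "wins_first Right (\<alpha> \<circledcirc> \<gamma>)" "\<gamma> \<noteq> []"
    and "\<And>\<alpha>' \<gamma>'. move Right (\<alpha> \<circledcirc> \<gamma>) (\<alpha>' \<circledcirc> \<gamma>') \<Longrightarrow> \<not> wins_first Left (\<alpha>' \<circledcirc> \<gamma>') \<Longrightarrow>
           \<not> wins_first Left ((\<zeta> @ \<alpha>') \<circledcirc> (\<gamma>' @ \<beta>))"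
  shows "wins_first Right ((\<zeta> @ \<alpha>) \<circledcirc> (\<gamma> @ \<beta>))"
proof (cases "hd \<gamma> = 0")
  case True
  then show ?thesis
    using assms(2) by (simp add: Right_wins_first_iff)
next
  case False
  then obtain \<delta> \<gamma>' where *: "\<gamma> = \<delta> @ \<gamma>'" "\<delta> \<noteq> []" "\<forall>d\<in>set \<delta>. 0 < d"
    and "\<not> wins_first Left ((\<alpha> @ map (\<lambda>d. d - 1) \<delta>) \<circledcirc> \<gamma>')"
    using assms(1,2) by (auto simp: Right_wins_first_iff)
  then have "\<not> wins_first Left ((\<zeta> @ \<alpha> @ map (\<lambda>d. d - 1) \<delta>) \<circledcirc> (\<gamma>' @ \<beta>))"
    using assms(3) move_Right by blast
  then show ?thesis
    unfolding Right_wins_first_iff using * by (metis append.assoc)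
qed

text \<open>The induction runs over pairs of moves, a roll by Left and an answer by Right, which
  together lower \<open>total_height\<close>. The bumps Left has just rolled over make the right row
  nonempty, as \<open>Right_wins_first_append\<close> demands.\<close>

lemma Left_loses_first_append_right:
  "\<not> wins_first Left (\<alpha> \<circledcirc> \<gamma>) \<Longrightarrow> \<not> wins_first Left (\<alpha> \<circledcirc> (\<gamma> @ \<beta>))"
proof (induction "total_height (\<alpha> \<circledcirc> \<gamma>)" arbitrary: \<alpha> \<gamma> rule: less_induct)
  case less
  have "wins_first Right H" if roll: "move Left (\<alpha> \<circledcirc> (\<gamma> @ \<beta>)) H" for H
  proof -
    obtain \<alpha>' \<delta> where *: "\<alpha> = \<alpha>' @ \<delta>" "\<delta> \<noteq> []" "\<forall>d\<in>set \<delta>. 0 < d"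
      and H: "H = \<alpha>' \<circledcirc> (map (\<lambda>d. d - 1) \<delta> @ \<gamma> @ \<beta>)"
      using roll unfolding move_Left_iff by blast
    let ?\<gamma> = "map (\<lambda>d. d - 1) \<delta> @ \<gamma>"
    have m: "move Left (\<alpha> \<circledcirc> \<gamma>) (\<alpha>' \<circledcirc> ?\<gamma>)"
      using * move_Left by blast
    have "wins_first Right (([] @ \<alpha>') \<circledcirc> (?\<gamma> @ \<beta>))"
    proof (rule Right_wins_first_append)
      show "wins_first Right (\<alpha>' \<circledcirc> ?\<gamma>)"
        using less.prems m Left_loses_first_iff by blast
      show "?\<gamma> \<noteq> []"
        using * by simp
      show "\<not> wins_first Left (([] @ \<alpha>'') \<circledcirc> (\<gamma>'' @ \<beta>))"
        if "move Right (\<alpha>' \<circledcirc> ?\<gamma>) (\<alpha>'' \<circledcirc> \<gamma>'')" "\<not> wins_first Left (\<alpha>'' \<circledcirc> \<gamma>'')" for \<alpha>'' \<gamma>''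
        using less.hyps[of \<alpha>'' \<gamma>''] that m move_total_height_less less_trans append_Nil by metis
    qed
    then show ?thesis
      by (simp add: H)
  qed
  \<comment> \<open>A stuck player wins, so a loss also requires a move; those of Left depend on the
    left row only.\<close>
  moreover have "\<exists>H. move Left (\<alpha> \<circledcirc> (\<gamma> @ \<beta>)) H"
    using less.prems by (auto simp: Left_loses_first_iff move_Left_iff)
  ultimately show ?case
    using Left_loses_first_iff by blast
qed

lemma Left_loses_first_append_left:
  assumes "\<not> wins_first Left (\<alpha> \<circledcirc> [])"
  shows "\<not> wins_first Left (\<gamma> \<circledcirc> \<beta>) \<Longrightarrow> \<not> wins_first Left ((\<alpha> @ \<gamma>) \<circledcirc> \<beta>)"
proof (induction "total_height (\<gamma> \<circledcirc> \<beta>)" arbitrary: \<gamma> \<beta> rule: less_induct)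
  case less
  have "wins_first Right H" if roll: "move Left ((\<alpha> @ \<gamma>) \<circledcirc> \<beta>) H" for H
  proof -
    obtain \<eta> \<delta> where *: "\<alpha> @ \<gamma> = \<eta> @ \<delta>" "\<delta> \<noteq> []" "\<forall>d\<in>set \<delta>. 0 < d"
      and H: "H = \<eta> \<circledcirc> (map (\<lambda>d. d - 1) \<delta> @ \<beta>)"
      using roll unfolding move_Left_iff by blast
    \<comment> \<open>Either the roll stays within \<open>\<gamma>\<close>, or it covers all of
      \<open>\<gamma>\<close> and a nonempty end \<open>\<epsilon>\<close> of
      \<open>\<alpha>\<close>.\<close>
    consider \<gamma>' where "\<eta> = \<alpha> @ \<gamma>'" "\<gamma> = \<gamma>' @ \<delta>"
      | \<epsilon> where "\<alpha> = \<eta> @ \<epsilon>" "\<delta> = \<epsilon> @ \<gamma>" "\<epsilon> \<noteq> []"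
      using *(1) unfolding append_eq_append_conv2 by (metis append_Nil append_Nil2)
    then show ?thesis
    proof cases
      case 1
      let ?\<beta> = "map (\<lambda>d. d - 1) \<delta> @ \<beta>"
      have m: "move Left (\<gamma> \<circledcirc> \<beta>) (\<gamma>' \<circledcirc> ?\<beta>)"
        using * 1 move_Left by blast
      have "wins_first Right ((\<alpha> @ \<gamma>') \<circledcirc> (?\<beta> @ []))"
      proof (rule Right_wins_first_append)
        show "wins_first Right (\<gamma>' \<circledcirc> ?\<beta>)"
          using less.prems m Left_loses_first_iff by blast
        show "?\<beta> \<noteq> []"
          using * by simp
        show "\<not> wins_first Left ((\<alpha> @ \<gamma>'') \<circledcirc> (\<beta>'' @ []))"
          if "move Right (\<gamma>' \<circledcirc> ?\<beta>) (\<gamma>'' \<circledcirc> \<beta>'')" "\<not> wins_first Left (\<gamma>'' \<circledcirc> \<beta>'')" for \<gamma>'' \<beta>''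
          using less.hyps[of \<gamma>'' \<beta>''] that m move_total_height_less less_trans append_Nil2 by metis
      qed
      then show ?thesis
        using 1 by (simp add: H)
    next
      case 2
      let ?\<epsilon> = "map (\<lambda>d. d - 1) \<epsilon>"
      \<comment> \<open>The part of the roll inside \<open>\<alpha>\<close> is itself a move in
        \<open>\<alpha> \<circledcirc> []\<close>, to which Right has a winning reply or is stuck.
        The lowered \<open>\<gamma>\<close> and \<open>\<beta>\<close> lie beyond
        \<open>?\<epsilon>\<close>, so they count as additions at the far right.\<close>
      have "move Left (\<alpha> \<circledcirc> []) (\<eta> \<circledcirc> (?\<epsilon> @ []))"
        using * 2 by (auto simp: move_Left_iff)
      then have "wins_first Right (\<eta> \<circledcirc> ?\<epsilon>)"
        using assms Left_loses_first_iff by auto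
      then have "wins_first Right (([] @ \<eta>) \<circledcirc> (?\<epsilon> @ map (\<lambda>d. d - 1) \<gamma> @ \<beta>))"
        by (rule Right_wins_first_append) (use 2 Left_loses_first_append_right in auto)
      then show ?thesis
        using 2 by (simp add: H)
    qed
  qed
  moreover have "\<exists>H. move Left ((\<alpha> @ \<gamma>) \<circledcirc> \<beta>) H"
    using less.prems by (auto simp: Left_loses_first_iff move_Left_iff) (metis append.assoc)
  ultimately show ?case
    using Left_loses_first_iff by blast
qed

text \<open>With \<open>\<beta>\<close> empty Right is stuck and wins. Otherwise Right plays as in
  \<open>[] \<circledcirc> \<beta>\<close>: a reply that is lost for Left stays lost once
  \<open>\<alpha>\<close> is put to its left.\<close>

lemma Right_wins_first_add_left:
  assumes "\<not> wins_first Left (\<alpha> \<circledcirc> [])" "wins_first Right ([] \<circledcirc> \<beta>)"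
  shows "wins_first Right (\<alpha> \<circledcirc> \<beta>)"
proof (cases "\<beta> = []")
  case True
  then show ?thesis
    by (simp add: Right_wins_first_iff)
next
  case False
  then have "wins_first Right ((\<alpha> @ []) \<circledcirc> (\<beta> @ []))"
    by (intro Right_wins_first_append[OF assms(2)])
      (use Left_loses_first_append_left[OF assms(1)] in auto)
  then show ?thesis
    by simp
qed

lemma Left_loses_first_add_right:
  "\<not> wins_first Left (\<alpha> \<circledcirc> []) \<Longrightarrow> \<not> wins_first Left (\<alpha> \<circledcirc> \<beta>)"
  using Left_loses_first_append_right[of \<alpha> "[]"] by simp

lemma wins_first_Left_mirror: "wins_first Left (\<alpha> \<circledcirc> \<beta>) \<longleftrightarrow> wins_first Right (rev \<beta> \<circledcirc> rev \<alpha>)"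
  using wins_first_mirror[of Left "\<alpha> \<circledcirc> \<beta>"] by simp

lemma wins_first_Right_mirror: "wins_first Right (\<alpha> \<circledcirc> \<beta>) \<longleftrightarrow> wins_first Left (rev \<beta> \<circledcirc> rev \<alpha>)"
  using wins_first_mirror[of Right "\<alpha> \<circledcirc> \<beta>"] by simp

lemma Left_wins_first_add_right:
  "\<not> wins_first Right ([] \<circledcirc> \<beta>) \<Longrightarrow> wins_first Left (\<alpha> \<circledcirc> []) \<Longrightarrow> wins_first Left (\<alpha> \<circledcirc> \<beta>)"
  using Right_wins_first_add_left[of "rev \<beta>" "rev \<alpha>"]
  \<comment> \<open>The instances are fixed because the two general equations would rewrite into
    each other forever.\<close>
  by (simp add: wins_first_Left_mirror[of \<alpha>] wins_first_Right_mirror[of "[]" \<beta>])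

lemma Right_loses_first_add_left:
  "\<not> wins_first Right ([] \<circledcirc> \<beta>) \<Longrightarrow> \<not> wins_first Right (\<alpha> \<circledcirc> \<beta>)"
  using Left_loses_first_add_right[of "rev \<beta>" "rev \<alpha>"]
  by (simp add: wins_first_Right_mirror[of _ \<beta>])

theorem theorem4:
  fixes \<alpha> \<beta> :: "nat list"
  assumes "\<forall>a\<in>set \<alpha>. 0 < a" and "\<forall>b\<in>set \<beta>. 0 < b"
  shows "(misere_outcome (\<alpha> \<circledcirc> []) = \<R> \<and> misere_outcome ([] \<circledcirc> \<beta>) = \<L>
            \<longrightarrow> misere_outcome (\<alpha> \<circledcirc> \<beta>) = \<P>) \<and>
         (misere_outcome (\<alpha> \<circledcirc> []) = \<R> \<and> misere_outcome ([] \<circledcirc> \<beta>) = \<N>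
            \<longrightarrow> misere_outcome (\<alpha> \<circledcirc> \<beta>) = \<R>) \<and>
         (misere_outcome (\<alpha> \<circledcirc> []) = \<N> \<and> misere_outcome ([] \<circledcirc> \<beta>) = \<L>
            \<longrightarrow> misere_outcome (\<alpha> \<circledcirc> \<beta>) = \<L>)"
  \<comment> \<open>For each player, losing or winning first on the own side alone carries over to
    \<open>\<alpha> \<circledcirc> \<beta>\<close>; a win carries over when the opponent loses first
    on the other side. In each of the three cases at least one player loses first, so both results
    transfer.\<close>
  using Left_loses_first_add_right[of \<alpha> \<beta>] Right_loses_first_add_left[of \<beta> \<alpha>]
    Left_wins_first_add_right[of \<beta> \<alpha>] Right_wins_first_add_left[of \<alpha> \<beta>]
  by (auto simp: misere_outcome_def split: if_splits)

end
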